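(* Consider a semi-explicit pHDAE on $\mathcal X=\mathcal X_1\times\mathcal X_2$ with $E=\mathrm{diag}(E_{11},0)$, $J,R,B$, $z=(z_1,z_2)$ and specified Hamiltonian $\mathcal H_1$. Let $\overline E_{11},\overline z_2,\overline J,\overline R,\overline B$ be consistent discretizations of $E_{11},z_2,J,R,B$, with $\overline E_{11}$ pointwise invertible on $\mathcal X\times\mathcal X$ and $\overline J=-\overline J^\top$, $\overline R=\overline R^\top\succeq0$ pointwise, and let $\overline\nabla\mathcal H_1$ be a discrete gradient of $\mathcal H_1$. Set $\overline E=\mathrm{diag}(\overline E_{11},0)$ and $\overline\nabla\mathcal H(x,x')=\begin{bmatrix}\overline\nabla\mathcal H_1(x_1,x_1')\\ 0\end{bmatrix}$. Let $h>0$. Then the semi-explicit discrete gradient method yields the same one-step method as the DDR-method completed by the constraint $f_2^{k,k+1}=\overline z_2(x^k,x^{k+1})$. That is, for $x^k,x^{k+1}\in\mathcal X$, $u^{k,k+1},y^{k,k+1}\in\mathbb R^m$ and $z_1^{k,k+1}\in\mathbb R^{n_1}$, the quantities $(x^k,x^{k+1},z_1^{k,k+1},u^{k,k+1},y^{k,k+1})$ satisfy the semi-explicit discrete gradient method if and only if $(x^k,x^{k+1},f^{k,k+1},u^{k,k+1},y^{k,k+1})$ with $f^{k,k+1}=(f_1^{k,k+1},f_2^{k,k+1})=(z_1^{k,k+1},\overline z_2(x^k,x^{k+1}))$ satisfies the DDR-method.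
   Context: A semi-explicit pHDAE is a system $E(x)\dot x=(J(x)-R(x))z(x)+B(x)u$, $y=B(x)^\top z(x)$, $x=(x_1,x_2)\in\mathcal X=\mathcal X_1\times\mathcal X_2$, where $\mathcal X_1\subseteq\mathbb R^{n_1}$ is open, $\mathcal X_2\subseteq\mathbb R^{n_2}$ is open and convex, $n=n_1+n_2$, $E,J,R\in C(\mathcal X,\mathbb R^{n,n})$, $B\in C(\mathcal X,\mathbb R^{n,m})$, $z=(z_1,z_2)\in C(\mathcal X,\mathbb R^{n_1}\times\mathbb R^{n_2})$, $J=-J^\top$, $R=R^\top\succeq0$ pointwise, $E=\mathrm{diag}(E_{11},0)$ with $E_{11}\in C(\mathcal X,\mathbb R^{n_1,n_1})$ pointwise invertible, and $E^\top z=\nabla\mathcal H$ on $\mathcal X$ for a Hamiltonian $\mathcal H\in C^1(\mathcal X,\mathbb R)$. The specified Hamiltonian is the function $\mathcal H_1\in C^1(\mathcal X_1,\mathbb R)$ with $\mathcal H_1(x_1)=\mathcal H(x_1,x_2)$, $\nabla\mathcal H_1(x_1)=\nabla_{x_1}\mathcal H(x_1,x_2)$ for all $(x_1,x_2)\in\mathcal X$ (it exists). A discrete gradient of $f\in C^1(\mathcal Y,\mathbb R)$, $\mathcal Y\subseteq\mathbb R^d$ open, is $\overline\nabla f\in C(\mathcal Y\times\mathcal Y,\mathbb R^d)$ with $\overline\nabla f(x,x')^\top(x'-x)=f(x')-f(x)$ and $\overline\nabla f(x,x)=\nabla f(x)$. A continuous $\overline F$ on $\mathcal X\times\mathcal X$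 is a consistent discretization of $F$ if $\overline F(x,x)=F(x)$ for all $x$. Below, barred matrix functions are evaluated at $(x^k,x^{k+1})$. Semi-explicit discrete gradient method (step from $x^k$ to $x^{k+1}$, unknowns $x^{k+1},z_1^{k,k+1},y^{k,k+1}$): with $\zeta=\begin{bmatrix}z_1^{k,k+1}\\ \overline z_2(x^k,x^{k+1})\end{bmatrix}$, $$\begin{bmatrix}\overline E_{11}&0\\ 0&0\end{bmatrix}(x^{k+1}-x^k)=h(\overline J-\overline R)\zeta+h\overline Bu^{k,k+1},\quad y^{k,k+1}=\overline B^\top\zeta,\quad \overline E_{11}^\top z_1^{k,k+1}=\overline\nabla\mathcal H_1(x_1^k,x_1^{k+1}).$$ DDR-method (step from $x^k$ to $x^{k+1}$, unknowns $x^{k+1},f^{k,k+1},y^{k,k+1}$): $$\begin{bmatrix}\overline\nabla\mathcal H(x^k,x^{k+1})\\ 0\\ y^{k,k+1}\end{bmatrix}+\begin{bmatrix}0&-\overline E^\top&0\\ \overline E&\overline J-\overline R&\overline B\\ 0&-\overline B^\top&0\end{bmatrix}\begin{bmatrix}-\frac1h(x^{k+1}-x^k)\\ f^{k,k+1}\\ u^{k,k+1}\end{bmatrix}=0.$$ *)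

theory Defs
  imports "HOL-Analysis.Analysis"
begin

text \<open>
  The space of dimension \<open>n = n\<^sub>1 + n\<^sub>2\<close> is modelled as \<open>real ^ ('n1::finite + 'n2::finite)\<close>: vectors indexed by the
  disjoint sum of the two index types.
\<close>

definition block_vec :: "real ^ 'a \<Rightarrow> real ^ 'b \<Rightarrow> real ^ ('a::finite + 'b::finite)"
  where "block_vec v w = (\<chi> i. case i of Inl k \<Rightarrow> v $ k | Inr k \<Rightarrow> w $ k)"

definition upper :: "real ^ ('a::finite + 'b::finite) \<Rightarrow> real ^ 'a"
  where "upper x = (\<chi> k. x $ Inl k)"

definition lower :: "real ^ ('a::finite + 'b::finite) \<Rightarrow> real ^ 'b"
  where "lower x = (\<chi> k. x $ Inr k)"

definition block_product :: "(real ^ 'a) set \<Rightarrow> (real ^ 'b) set \<Rightarrow> (real ^ ('a::finite + 'b::finite)) set"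
  where "block_product X1 X2 = {x. upper x \<in> X1 \<and> lower x \<in> X2}"

definition block_diag :: "real ^ 'a ^ 'c \<Rightarrow> real ^ 'b ^ 'd \<Rightarrow> real ^ ('a::finite + 'b::finite) ^ ('c::finite + 'd::finite)"
  where "block_diag A D = (\<chi> i. case i of
     Inl k \<Rightarrow> block_vec (A $ k) 0
   | Inr k \<Rightarrow> block_vec 0 (D $ k))"

text \<open>Arguments are listed row by row; \<open>A $ k\<close> is the \<open>k\<close>-th row of \<open>A\<close>.\<close>

definition block_mat3 ::
  "real ^ 'a ^ 'd \<Rightarrow> real ^ 'b ^ 'd \<Rightarrow> real ^ 'c ^ 'd \<Rightarrow>
   real ^ 'a ^ 'e \<Rightarrow> real ^ 'b ^ 'e \<Rightarrow> real ^ 'c ^ 'e \<Rightarrow>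
   real ^ 'a ^ 'f \<Rightarrow> real ^ 'b ^ 'f \<Rightarrow> real ^ 'c ^ 'f \<Rightarrow>
   real ^ ('a::finite + ('b::finite + 'c::finite)) ^ ('d::finite + ('e::finite + 'f::finite))"
  where "block_mat3 A11 A12 A13 A21 A22 A23 A31 A32 A33 = (\<chi> i. case i of
     Inl k \<Rightarrow> block_vec (A11 $ k) (block_vec (A12 $ k) (A13 $ k))
   | Inr (Inl k) \<Rightarrow> block_vec (A21 $ k) (block_vec (A22 $ k) (A23 $ k))
   | Inr (Inr k) \<Rightarrow> block_vec (A31 $ k) (block_vec (A32 $ k) (A33 $ k)))"

definition skew_symmetric :: "real ^ 'n ^ 'n \<Rightarrow> bool"
  where "skew_symmetric A \<longleftrightarrow> A = - transpose A"

definition pos_semidef :: "real ^ 'n ^ 'n \<Rightarrow> bool"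
  where "pos_semidef A \<longleftrightarrow> A = transpose A \<and> (\<forall>v. 0 \<le> v \<bullet> (A *v v))"

text \<open>Used only for open \<open>S\<close>, so that the full derivative \<open>GDERIV\<close> is the appropriate one.\<close>

definition C1_on :: "'a::real_inner set \<Rightarrow> ('a \<Rightarrow> real) \<Rightarrow> bool"
  where "C1_on S f \<longleftrightarrow> (\<exists>g. continuous_on S g \<and> (\<forall>x\<in>S. GDERIV f x :> g x))"

definition discrete_gradient_on ::
  "'a::real_inner set \<Rightarrow> ('a \<Rightarrow> real) \<Rightarrow> ('a \<Rightarrow> 'a \<Rightarrow> 'a) \<Rightarrow> bool"
  where "discrete_gradient_on Y f DG \<longleftrightarrow>
     continuous_on (Y \<times> Y) (\<lambda>(x, x'). DG x x') \<and>
     (\<forall>x\<in>Y. \<forall>x'\<in>Y. DG x x' \<bullet> (x' - x) = f x' - f x) \<and>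
     (\<forall>x\<in>Y. GDERIV f x :> DG x x)"

definition consistent_discretization_on ::
  "'a::topological_space set \<Rightarrow> ('a \<Rightarrow> 'b::topological_space) \<Rightarrow> ('a \<Rightarrow> 'a \<Rightarrow> 'b) \<Rightarrow> bool"
  where "consistent_discretization_on X F Fbar \<longleftrightarrow>
     continuous_on (X \<times> X) (\<lambda>(x, x'). Fbar x x') \<and> (\<forall>x\<in>X. Fbar x x = F x)"

text \<open>
  The data of a semi-explicit port-Hamiltonian descriptor system
  \<open>E(x) dx/dt = (J(x) - R(x)) z(x) + B(x) u\<close>, \<open>y = B(x)\<^sup>T z(x)\<close>.  All coefficient functions are total; only
  their values on the state space are constrained.
\<close>

locale semi_explicit_pHDAE =
  fixes X1 :: "(real ^ 'n1) set"
    and X2 :: "(real ^ 'n2) set"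
    and E :: "real ^ ('n1::finite + 'n2::finite) \<Rightarrow> real ^ ('n1::finite + 'n2::finite) ^ ('n1::finite + 'n2::finite)"
    and E11 :: "real ^ ('n1::finite + 'n2::finite) \<Rightarrow> real ^ 'n1 ^ 'n1"
    and J R :: "real ^ ('n1::finite + 'n2::finite) \<Rightarrow> real ^ ('n1::finite + 'n2::finite) ^ ('n1::finite + 'n2::finite)"
    and B :: "real ^ ('n1::finite + 'n2::finite) \<Rightarrow> real ^ 'm ^ ('n1::finite + 'n2::finite)"
    and z :: "real ^ ('n1::finite + 'n2::finite) \<Rightarrow> real ^ ('n1::finite + 'n2::finite)"
    and H :: "real ^ ('n1::finite + 'n2::finite) \<Rightarrow> real"
  assumes open_X1: "open X1"
    and open_X2: "open X2"
    and convex_X2: "convex X2"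
    and continuous_E: "continuous_on (block_product X1 X2) E"
    and continuous_E11: "continuous_on (block_product X1 X2) E11"
    and continuous_J: "continuous_on (block_product X1 X2) J"
    and continuous_R: "continuous_on (block_product X1 X2) R"
    and continuous_B: "continuous_on (block_product X1 X2) B"
    and continuous_z: "continuous_on (block_product X1 X2) z"
    and E_block: "\<And>x. x \<in> block_product X1 X2 \<Longrightarrow> E x = block_diag (E11 x) 0"
    and invertible_E11: "\<And>x. x \<in> block_product X1 X2 \<Longrightarrow> invertible (E11 x)"
    and skew_J: "\<And>x. x \<in> block_product X1 X2 \<Longrightarrow> skew_symmetric (J x)"
    and psd_R: "\<And>x. x \<in> block_product X1 X2 \<Longrightarrow> pos_semidef (R x)"
    and C1_H: "C1_on (block_product X1 X2) H"
    and gradient_H: "\<And>x. x \<in> block_product X1 X2 \<Longrightarrow> GDERIV H x :> transpose (E x) *v z x"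

text \<open>In the last conjunct the second \<open>GDERIV\<close> is the partial gradient of \<open>H\<close> with respect to \<open>x\<^sub>1\<close>.\<close>

definition specified_Hamiltonian ::
  "(real ^ 'n1) set \<Rightarrow> (real ^ 'n2) set \<Rightarrow> (real ^ ('n1::finite + 'n2::finite) \<Rightarrow> real) \<Rightarrow> (real ^ 'n1 \<Rightarrow> real) \<Rightarrow> bool"
  where "specified_Hamiltonian X1 X2 H H1 \<longleftrightarrow>
     C1_on X1 H1 \<and>
     (\<forall>x1\<in>X1. \<forall>x2\<in>X2. H1 x1 = H (block_vec x1 x2)) \<and>
     (\<forall>x1\<in>X1. \<forall>x2\<in>X2. \<exists>g. GDERIV H1 x1 :> g \<and> GDERIV (\<lambda>\<xi>. H (block_vec \<xi> x2)) x1 :> g)"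

definition semi_explicit_discrete_gradient_step ::
  "(real ^ ('n1::finite + 'n2::finite) \<Rightarrow> real ^ ('n1::finite + 'n2::finite) \<Rightarrow> real ^ 'n1 ^ 'n1) \<Rightarrow>
   (real ^ ('n1::finite + 'n2::finite) \<Rightarrow> real ^ ('n1::finite + 'n2::finite) \<Rightarrow> real ^ 'n2) \<Rightarrow>
   (real ^ ('n1::finite + 'n2::finite) \<Rightarrow> real ^ ('n1::finite + 'n2::finite) \<Rightarrow> real ^ ('n1::finite + 'n2::finite) ^ ('n1::finite + 'n2::finite)) \<Rightarrow>
   (real ^ ('n1::finite + 'n2::finite) \<Rightarrow> real ^ ('n1::finite + 'n2::finite) \<Rightarrow> real ^ ('n1::finite + 'n2::finite) ^ ('n1::finite + 'n2::finite)) \<Rightarrow>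
   (real ^ ('n1::finite + 'n2::finite) \<Rightarrow> real ^ ('n1::finite + 'n2::finite) \<Rightarrow> real ^ 'm ^ ('n1::finite + 'n2::finite)) \<Rightarrow>
   (real ^ 'n1 \<Rightarrow> real ^ 'n1 \<Rightarrow> real ^ 'n1) \<Rightarrow> real \<Rightarrow>
   real ^ ('n1::finite + 'n2::finite) \<Rightarrow> real ^ ('n1::finite + 'n2::finite) \<Rightarrow> real ^ 'n1 \<Rightarrow> real ^ 'm \<Rightarrow> real ^ 'm \<Rightarrow> bool"
  where "semi_explicit_discrete_gradient_step E11bar z2bar Jbar Rbar Bbar DH1 h x x' z1 u y \<longleftrightarrow>
     (let \<zeta> = block_vec z1 (z2bar x x') in
       block_diag (E11bar x x') 0 *v (x' - x) =
         h *\<^sub>R ((Jbar x x' - Rbar x x') *v \<zeta>) + h *\<^sub>R (Bbar x x' *v u) \<and>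
       y = transpose (Bbar x x') *v \<zeta> \<and>
       transpose (E11bar x x') *v z1 = DH1 (upper x) (upper x'))"

definition DDR_step ::
  "(real ^ 'n \<Rightarrow> real ^ 'n \<Rightarrow> real ^ 'n ^ 'n) \<Rightarrow>
   (real ^ 'n \<Rightarrow> real ^ 'n \<Rightarrow> real ^ 'n ^ 'n) \<Rightarrow>
   (real ^ 'n \<Rightarrow> real ^ 'n \<Rightarrow> real ^ 'n ^ 'n) \<Rightarrow>
   (real ^ 'n \<Rightarrow> real ^ 'n \<Rightarrow> real ^ 'm ^ 'n) \<Rightarrow>
   (real ^ 'n \<Rightarrow> real ^ 'n \<Rightarrow> real ^ 'n) \<Rightarrow> real \<Rightarrow>
   real ^ 'n \<Rightarrow> real ^ 'n \<Rightarrow> real ^ 'n \<Rightarrow> real ^ 'm \<Rightarrow> real ^ 'm \<Rightarrow> bool"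
  where "DDR_step Ebar Jbar Rbar Bbar DH h x x' f u y \<longleftrightarrow>
     block_vec (DH x x') (block_vec (0 :: real ^ 'n) y)
     + block_mat3
         0             (- transpose (Ebar x x'))  0
         (Ebar x x')   (Jbar x x' - Rbar x x')    (Bbar x x')
         0             (- transpose (Bbar x x'))  0
       *v block_vec (- (1 / h) *\<^sub>R (x' - x)) (block_vec f u)
     = 0"

end

theory Submission
  imports Defs
begin

text \<open>For a fixed step both methods are the same three equations. Multiplying out the block
  system of the DDR-method (\<open>DDR_step_iff\<close>) leaves a gradient condition
  \<open>DH = transpose Ebar *v f\<close>, a balance equation with increment scaled by
  \<open>1 / h\<close>, and an output equation. Put \<open>f = (z1, z2bar)\<close>, which is exactly
  \<zeta>. The output equations then agree literally, and the balance equations agree after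
  multiplication by \<open>h\<close>. Since \<open>Ebar\<close> is block diagonal with zero lower
  block and \<open>DH\<close> has zero lower part, the lower half of the gradient condition reads 0
  = 0 and its upper half is the equation defining \<open>z1\<close>. The remaining lemmas are block
  arithmetic.\<close>

lemma block_vec_nth [simp]:
  "block_vec v w $ Inl i = v $ i"
  "block_vec v w $ Inr j = w $ j"
  by (simp_all add: block_vec_def)

lemma block_vec_eq_iff: "block_vec v w = block_vec v' w' \<longleftrightarrow> v = v' \<and> w = w'"
  by (simp add: vec_eq_iff split_sum_all)

lemma block_vec_eq_0_iff: "block_vec v w = 0 \<longleftrightarrow> v = 0 \<and> w = 0"
  by (simp add: vec_eq_iff split_sum_all)

lemma block_vec_add: "block_vec v w + block_vec v' w' = block_vec (v + v') (w + w')"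
  by (simp add: vec_eq_iff split_sum_all)

text \<open>A sum over the disjoint union of the index types splits in two. Entries of a
  matrix-vector product are inner products with rows, so this identity yields both block
  multiplication rules below.\<close>

lemma inner_block_vec: "block_vec v w \<bullet> block_vec v' w' = v \<bullet> v' + w \<bullet> w'"
  unfolding inner_vec_def by (subst UNIV_Plus_UNIV [symmetric], subst sum.Plus) simp_all

lemma block_diag_mult_block_vec:
  "block_diag A D *v block_vec v w = block_vec (A *v v) (D *v w)"
  by (simp add: vec_eq_iff split_sum_all matrix_vector_mul_component block_diag_def inner_block_vec)

lemma transpose_block_diag:
  "transpose (block_diag A D) = block_diag (transpose A) (transpose D)"
  by (simp add: vec_eq_iff transpose_def block_diag_def block_vec_def split: sum.split)

lemma block_mat3_mult_block_vec:
  "block_mat3 A11 A12 A13 A21 A22 A23 A31 A32 A33 *v block_vec a (block_vec b c) =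
   block_vec (A11 *v a + A12 *v b + A13 *v c)
     (block_vec (A21 *v a + A22 *v b + A23 *v c) (A31 *v a + A32 *v b + A33 *v c))"
  by (simp add: vec_eq_iff split_sum_all matrix_vector_mul_component block_mat3_def inner_block_vec)

lemma minus_matrix_vector_mult: "(- A) *v x = - (A *v x)" for A :: "real ^ 'n ^ 'm"
  by (simp add: vec_eq_iff matrix_vector_mul_component)

lemma diff_add_eq_0_iff: "a - b + c = 0 \<longleftrightarrow> b = a + c" for a b c :: "'a :: ab_group_add"
  unfolding diff_add_eq right_minus_eq by (rule eq_commute)

text \<open>The three block rows of the DDR system, each solved for the term that carries a minus
  sign or for \<open>y\<close>. It holds for arbitrary coefficients, with no block structure on
  \<open>Ebar\<close>.\<close>

lemma DDR_step_iff:
  "DDR_step Ebar Jbar Rbar Bbar DH h x x' f u y \<longleftrightarrow>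
     DH x x' = transpose (Ebar x x') *v f \<and>
     (1 / h) *\<^sub>R (Ebar x x' *v (x' - x)) = (Jbar x x' - Rbar x x') *v f + Bbar x x' *v u \<and>
     y = transpose (Bbar x x') *v f"
proof -
  \<comment> \<open>Pulling the scalar out of the product exposes the minus sign, so that the scaled
    increment can be moved to the other side of the second row.\<close>
  have "Ebar x x' *v (- (1 / h) *\<^sub>R (x' - x)) = - ((1 / h) *\<^sub>R (Ebar x x' *v (x' - x)))"
    by (subst matrix_vector_mult_scaleR) (rule scaleR_minus_left)
  then show ?thesis
    unfolding DDR_step_def block_mat3_mult_block_vec block_vec_add block_vec_eq_0_iff
    by (simp add: minus_matrix_vector_mult diff_add_eq_0_iff)
qed

theorem theorem5p3:
  fixes X1 :: "(real ^ 'n1) set" and X2 :: "(real ^ 'n2) set"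
    and X :: "(real ^ ('n1::finite + 'n2::finite)) set"
    and E J R :: "real ^ ('n1::finite + 'n2::finite) \<Rightarrow> real ^ ('n1::finite + 'n2::finite) ^ ('n1::finite + 'n2::finite)"
    and E11 :: "real ^ ('n1::finite + 'n2::finite) \<Rightarrow> real ^ 'n1 ^ 'n1"
    and B :: "real ^ ('n1::finite + 'n2::finite) \<Rightarrow> real ^ 'm ^ ('n1::finite + 'n2::finite)"
    and z :: "real ^ ('n1::finite + 'n2::finite) \<Rightarrow> real ^ ('n1::finite + 'n2::finite)"
    and H :: "real ^ ('n1::finite + 'n2::finite) \<Rightarrow> real" and H1 :: "real ^ 'n1 \<Rightarrow> real"
    and E11bar :: "real ^ ('n1::finite + 'n2::finite) \<Rightarrow> real ^ ('n1::finite + 'n2::finite) \<Rightarrow> real ^ 'n1 ^ 'n1"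
    and z2bar :: "real ^ ('n1::finite + 'n2::finite) \<Rightarrow> real ^ ('n1::finite + 'n2::finite) \<Rightarrow> real ^ 'n2"
    and Ebar Jbar Rbar ::
      "real ^ ('n1::finite + 'n2::finite) \<Rightarrow> real ^ ('n1::finite + 'n2::finite) \<Rightarrow> real ^ ('n1::finite + 'n2::finite) ^ ('n1::finite + 'n2::finite)"
    and Bbar :: "real ^ ('n1::finite + 'n2::finite) \<Rightarrow> real ^ ('n1::finite + 'n2::finite) \<Rightarrow> real ^ 'm ^ ('n1::finite + 'n2::finite)"
    and DH1 :: "real ^ 'n1 \<Rightarrow> real ^ 'n1 \<Rightarrow> real ^ 'n1"
    and DH :: "real ^ ('n1::finite + 'n2::finite) \<Rightarrow> real ^ ('n1::finite + 'n2::finite) \<Rightarrow> real ^ ('n1::finite + 'n2::finite)"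
    and h :: real
    and xk xk1 :: "real ^ ('n1::finite + 'n2::finite)" and z1 :: "real ^ 'n1" and u y :: "real ^ 'm"
  assumes X: "X = block_product X1 X2"
    and system: "semi_explicit_pHDAE X1 X2 E E11 J R B z H"
    and H1: "specified_Hamiltonian X1 X2 H H1"
    and E11bar: "consistent_discretization_on X E11 E11bar"
    and z2bar: "consistent_discretization_on X (\<lambda>x. lower (z x)) z2bar"
    and Jbar: "consistent_discretization_on X J Jbar"
    and Rbar: "consistent_discretization_on X R Rbar"
    and Bbar: "consistent_discretization_on X B Bbar"
    and E11bar_inv: "\<And>x x'. x \<in> X \<Longrightarrow> x' \<in> X \<Longrightarrow> invertible (E11bar x x')"
    and Jbar_skew: "\<And>x x'. x \<in> X \<Longrightarrow> x' \<in> X \<Longrightarrow> skew_symmetric (Jbar x x')"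
    and Rbar_psd: "\<And>x x'. x \<in> X \<Longrightarrow> x' \<in> X \<Longrightarrow> pos_semidef (Rbar x x')"
    and DH1: "discrete_gradient_on X1 H1 DH1"
    and Ebar: "\<And>x x'. x \<in> X \<Longrightarrow> x' \<in> X \<Longrightarrow> Ebar x x' = block_diag (E11bar x x') 0"
    and DH: "\<And>x x'. x \<in> X \<Longrightarrow> x' \<in> X \<Longrightarrow> DH x x' = block_vec (DH1 (upper x) (upper x')) 0"
    and h: "h > 0"
    and xk: "xk \<in> X" and xk1: "xk1 \<in> X"
  shows "semi_explicit_discrete_gradient_step E11bar z2bar Jbar Rbar Bbar DH1 h xk xk1 z1 u y \<longleftrightarrow>
    DDR_step Ebar Jbar Rbar Bbar DH h xk xk1 (block_vec z1 (z2bar xk xk1)) u y"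
proof -
  \<comment> \<open>The right-hand product is \<open>(transpose E11bar *v z1, 0)\<close>, so only
    the upper components give a condition; \<open>eq_commute\<close> turns it to the orientation
    used by the discrete gradient step.\<close>
  have grad: "DH xk xk1 = transpose (Ebar xk xk1) *v block_vec z1 (z2bar xk xk1) \<longleftrightarrow>
      transpose (E11bar xk xk1) *v z1 = DH1 (upper xk) (upper xk1)"
    by (simp add: Ebar DH xk xk1 transpose_block_diag block_diag_mult_block_vec block_vec_eq_iff
        eq_commute [of "DH1 (upper xk) (upper xk1)"])
  \<comment> \<open>Positivity of \<open>h\<close> enters here, as \<open>h\<close> being
    nonzero.\<close>
  have scale: "(1 / h) *\<^sub>R v = a + b \<longleftrightarrow> v = h *\<^sub>R a + h *\<^sub>R b" for v a b :: "real ^ ('n1 + 'n2)"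
    using h by (simp add: vector_fraction_eq_iff scaleR_add_right)
  show ?thesis
    unfolding semi_explicit_discrete_gradient_step_def DDR_step_iff grad scale Let_def
    \<comment> \<open>\<open>Ebar\<close> is expanded only now because the left side of
      \<open>grad\<close> mentions it; what remains is a reordering of the three conjuncts.\<close>
    unfolding Ebar [OF xk xk1] by blast
qed

end
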